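(* Let $G$ and $H$ be graphs. If $G\cong_{\mathcal S_+}H$, then $G$ and $H$ have cospectral adjacency matrices, and so do their complements $\overline G$ and $\overline H$.
   Context: Graphs are finite, simple and undirected. Matrices are cospectral if they have the same multiset of eigenvalues. For vertices $x,y$ of the same graph, $\mathrm{rel}(x,y)$ denotes their relationship: equal, adjacent, or distinct non-adjacent. $\mathcal S_+$ is the cone of (Hermitian) positive semidefinite matrices. $G\cong_{\mathcal S_+}H$ means: there is $M\in\mathcal S_+$ with rows and columns indexed by $V_G\times V_H$ such that $\sum_{h,h'\in V_H}M_{gh,g'h'}=1$ for all $g,g'\in V_G$; $\sum_{g,g'\in V_G}M_{gh,g'h'}=1$ for all $h,h'\in V_H$; and $M_{gh,g'h'}=0$ whenever $\mathrm{rel}(g,g')\neq\mathrm{rel}(h,h')$. *)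

theory Defs
  imports
    "HOL-Computational_Algebra.Polynomial"
    "Jordan_Normal_Form.Char_Poly"
    "Graph_Theory.Pair_Digraph"
begin

text \<open>
  A finite simple undirected graph is a \<open>pair_graph\<close>: its arc set \<open>parcs G\<close> is a finite,
  symmetric, irreflexive relation on the finite vertex set \<open>pverts G\<close>, which may be empty.
\<close>

datatype relationship = Equal | Adjacent | NonAdjacent

definition rel :: "'a pair_pre_digraph \<Rightarrow> 'a \<Rightarrow> 'a \<Rightarrow> relationship" where
  "rel G x y = (if x = y then Equal else if (x, y) \<in> parcs G then Adjacent else NonAdjacent)"

definition complement :: "'a pair_pre_digraph \<Rightarrow> 'a pair_pre_digraph" where
  "complement G =
     \<lparr> pverts = pverts G,
       parcs = {(x, y). x \<in> pverts G \<and> y \<in> pverts G \<and> x \<noteq> y \<and> (x, y) \<notin> parcs G} \<rparr>"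

lemma pair_graph_complement:
  assumes "pair_graph G"
  shows "pair_graph (complement G)"
proof -
  interpret pair_graph G by fact
  have fin: "finite (parcs (complement G))"
    by (rule finite_subset[of _ "pverts G \<times> pverts G"])
       (auto simp: complement_def pair_finite_verts)
  show ?thesis
    using fin pair_finite_verts pair_sym_arcs
    by unfold_locales (auto simp: complement_def symmetric_def sym_def)
qed

text \<open>
  A matrix with rows and columns indexed by a finite set \<open>I\<close> is a function whose values outside
  \<open>I\<close> are irrelevant. In the second clause the quadratic form is real because of the first one.
\<close>

definition psd_on :: "'i set \<Rightarrow> ('i \<Rightarrow> 'i \<Rightarrow> complex) \<Rightarrow> bool" where
  "psd_on I M \<longleftrightarrow>
     (\<forall>i\<in>I. \<forall>j\<in>I. M j i = cnj (M i j)) \<and>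
     (\<forall>v. 0 \<le> Re (\<Sum>i\<in>I. \<Sum>j\<in>I. cnj (v i) * M i j * v j))"

definition psd_isomorphic :: "'a pair_pre_digraph \<Rightarrow> 'b pair_pre_digraph \<Rightarrow> bool"
    (infix \<open>\<cong>\<^sub>S\<^sub>+\<close> 50) where
  "G \<cong>\<^sub>S\<^sub>+ H \<longleftrightarrow>
     (\<exists>M. psd_on (pverts G \<times> pverts H) M \<and>
        (\<forall>g\<in>pverts G. \<forall>g'\<in>pverts G.
           (\<Sum>h\<in>pverts H. \<Sum>h'\<in>pverts H. M (g, h) (g', h')) = 1) \<and>
        (\<forall>h\<in>pverts H. \<forall>h'\<in>pverts H.
           (\<Sum>g\<in>pverts G. \<Sum>g'\<in>pverts G. M (g, h) (g', h')) = 1) \<and>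
        (\<forall>g\<in>pverts G. \<forall>g'\<in>pverts G. \<forall>h\<in>pverts H. \<forall>h'\<in>pverts H.
           rel G g g' \<noteq> rel H h h' \<longrightarrow> M (g, h) (g', h') = 0))"

text \<open>
  The rows and columns of a \<^typ>\<open>complex mat\<close> are numbered, so the adjacency matrix is taken with
  respect to a listing \<open>xs\<close> of the vertices, each vertex occurring exactly once.
\<close>

definition adjacency_matrix :: "'a list \<Rightarrow> 'a pair_pre_digraph \<Rightarrow> complex mat" where
  "adjacency_matrix xs G =
     mat (length xs) (length xs) (\<lambda>(i, j). if (xs ! i, xs ! j) \<in> parcs G then 1 else 0)"

text \<open>Eigenvalues are counted with their algebraic multiplicity.\<close>

definition eigenvalue_mset :: "complex mat \<Rightarrow> complex multiset" where
  "eigenvalue_mset A = proots (char_poly A)"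

lemma set_eigenvalue_mset:
  assumes "A \<in> carrier_mat n n"
  shows "set_mset (eigenvalue_mset A) = {k. eigenvalue A k}"
proof -
  have "char_poly A \<noteq> 0"
    using degree_monic_char_poly[OF assms] by auto
  then show ?thesis
    by (auto simp: eigenvalue_mset_def eigenvalue_root_char_poly[OF assms])
qed

definition cospectral :: "complex mat \<Rightarrow> complex mat \<Rightarrow> bool" where
  "cospectral A B \<longleftrightarrow> eigenvalue_mset A = eigenvalue_mset B"

end

theory Submission
  imports Defs "Jordan_Normal_Form.Schur_Decomposition"
begin

text \<open>
  View \<open>M\<close> as the Gram matrix of vectors \<open>e g h\<close>. The linear conditions on \<open>M\<close> force
  \<open>\<Sum>\<^sub>x A g x e x h = \<Sum>\<^sub>y B y h e g y\<close>, because the squared norms of the differences add up to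
  zero; here \<open>A\<close> and \<open>B\<close> are the adjacency matrices. So every row of \<open>M\<close>, read as a matrix
  \<open>N\<close> with rows indexed by \<open>G\<close> and columns by \<open>H\<close>, satisfies \<open>A N = N B\<close> and hence
  \<open>A\<^sup>k N = N B\<^sup>k\<close>. Summing suitable entries yields \<open>tr A\<^sup>k = tr B\<^sup>k\<close> for all \<open>k\<close>, and these
  power sums of the eigenvalues determine their multiset. The same \<open>M\<close> relates the complements.
\<close>

section \<open>Power sums determine a multiset\<close>

text \<open>By linearity the sum is a combination of power sums, weighted by the coefficients of
  \<open>p\<close>.\<close>

lemma sum_mset_poly_eq_if_power_sums_eq:
  fixes M N :: "'a::comm_ring_1 multiset"
  assumes "\<And>k. (\<Sum>x\<in>#M. x ^ k) = (\<Sum>x\<in>#N. x ^ k)"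
  shows "(\<Sum>x\<in>#M. poly p x) = (\<Sum>x\<in>#N. poly p x)"
proof -
  have "(\<Sum>x\<in>#K. poly p x) = (\<Sum>i\<le>degree p. coeff p i * (\<Sum>x\<in>#K. x ^ i))" for K
    by (induction K) (simp_all add: poly_altdef distrib_left sum.distrib del: sum_mset_distrib_left)
  then show ?thesis by (simp only: assms)
qed

text \<open>A polynomial that vanishes at every element other than \<open>a\<close>, but not at
  \<open>a\<close>, turns the sum over either multiset into the multiplicity of \<open>a\<close>
  times a nonzero constant. Characteristic zero lets multiplicities be compared as field
  elements.\<close>

lemma multiset_eq_if_power_sums_eq:
  fixes M N :: "'a::field_char_0 multiset"
  assumes "\<And>k. (\<Sum>x\<in>#M. x ^ k) = (\<Sum>x\<in>#N. x ^ k)"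
  shows "M = N"
proof (rule multiset_eqI)
  fix a
  define p where "p = (\<Prod>b\<in>set_mset M \<union> set_mset N - {a}. [:- b, 1:])"
  have pa: "poly p a \<noteq> 0"
    by (auto simp: p_def poly_prod)
  \<comment> \<open>Restricting to submultisets ensures that every element met in the induction is
    \<open>a\<close> or a root of \<open>p\<close>.\<close>
  have count: "(\<Sum>x\<in>#K. poly p x) = of_nat (count K a) * poly p a" if "K \<subseteq># M \<or> K \<subseteq># N" for K
    using that
  proof (induction K)
    case (add b K)
    then have b: "b \<in> set_mset M \<union> set_mset N" and K: "K \<subseteq># M \<or> K \<subseteq># N"
      by (auto dest: mset_subset_eq_insertD mset_subset_eqD subset_mset.less_imp_le)
    have "poly p b = 0" if "b \<noteq> a"
      using b that by (auto simp: p_def poly_prod intro!: prod_zero)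
    then show ?case
      using add.IH[OF K] by (auto simp: algebra_simps)
  qed simp
  have "of_nat (count M a) * poly p a = of_nat (count N a) * poly p a"
    using sum_mset_poly_eq_if_power_sums_eq[OF assms, of p] by (simp add: count)
  then show "count M a = count N a"
    using pa by simp
qed

section \<open>Traces of powers\<close>

text \<open>A term \<open>X $$ (i, k) * Y $$ (k, j)\<close> can be nonzero only if i \<le> k \<le>
  j, so for j \<le> i only k = i = j survives. This gives at once the zeros below the diagonal and
  the diagonal of the product.\<close>

lemma upper_triangular_mult_index:
  fixes X Y :: "'a::semiring_0 mat"
  assumes X: "X \<in> carrier_mat n n" "upper_triangular X"
    and Y: "Y \<in> carrier_mat n n" "upper_triangular Y"
    and "j \<le> i" "i < n"
  shows "(X * Y) $$ (i, j) = (if i = j then X $$ (i, i) * Y $$ (i, i) else 0)"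
proof -
  have "X $$ (i, k) * Y $$ (k, j) = (if k = i \<and> i = j then X $$ (i, i) * Y $$ (i, i) else 0)"
    if "k < n" for k
    using assms that upper_triangularD[OF X(2), of k i] upper_triangularD[OF Y(2), of j k]
    by (cases k i rule: linorder_cases) auto
  then have "(X * Y) $$ (i, j)
      = (\<Sum>k<n. if k = i \<and> i = j then X $$ (i, i) * Y $$ (i, i) else 0)"
    using assms by (simp add: scalar_prod_def atLeast0LessThan)
  also have "\<dots> = (if i = j then X $$ (i, i) * Y $$ (i, i) else 0)"
    using assms by (cases "i = j") simp_all
  finally show ?thesis .
qed

lemma upper_triangular_pow:
  fixes X :: "'a::semiring_1 mat"
  assumes X: "X \<in> carrier_mat n n" "upper_triangular X"
  shows "upper_triangular (X ^\<^sub>m k) \<and> (\<forall>i<n. (X ^\<^sub>m k) $$ (i, i) = X $$ (i, i) ^ k)"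
proof (induction k)
  case 0
  show ?case using X by simp
next
  case (Suc k)
  have C: "X ^\<^sub>m k \<in> carrier_mat n n" using X(1) by simp
  show ?case
    using X Suc upper_triangular_mult_index[OF C _ X]
    by (auto intro!: upper_triangularI simp: power_commutes)
qed

definition trace_mat :: "'a::comm_monoid_add mat \<Rightarrow> 'a" where
  "trace_mat A = (\<Sum>i<dim_row A. A $$ (i, i))"

lemma trace_mat_comm:
  fixes X Y :: "'a::comm_semiring_0 mat"
  assumes "X \<in> carrier_mat n m" "Y \<in> carrier_mat m n"
  shows "trace_mat (X * Y) = trace_mat (Y * X)"
proof -
  have "trace_mat (X * Y) = (\<Sum>i<n. \<Sum>j<m. X $$ (i, j) * Y $$ (j, i))"
    using assms by (simp add: trace_mat_def scalar_prod_def atLeast0LessThan)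
  also have "\<dots> = (\<Sum>j<m. \<Sum>i<n. Y $$ (j, i) * X $$ (i, j))"
    by (subst sum.swap) (simp add: mult.commute)
  also have "\<dots> = trace_mat (Y * X)"
    using assms by (simp add: trace_mat_def scalar_prod_def atLeast0LessThan)
  finally show ?thesis .
qed

text \<open>Since \<open>A = P * B * Q\<close> and \<open>Q * P\<close> is the identity, this is
  cyclicity of the trace.\<close>

lemma trace_mat_similar:
  fixes A B :: "'a::comm_ring_1 mat"
  assumes "similar_mat_wit A B P Q"
  shows "trace_mat A = trace_mat B"
proof -
  define n where "n = dim_row A"
  note wit = similar_mat_witD[OF n_def assms]
  have "trace_mat (P * B * Q) = trace_mat (Q * (P * B))"
    by (rule trace_mat_comm[OF mult_carrier_mat[OF wit(6,5)] wit(7)])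
  also have "Q * (P * B) = B"
    using assoc_mult_mat[OF wit(7,6,5)] left_mult_one_mat[OF wit(5)] wit(2) by simp
  finally show ?thesis
    by (simp only: wit(3))
qed

text \<open>By Schur decomposition \<open>A\<close> is similar to an upper triangular
  \<open>T\<close> whose diagonal lists the eigenvalues with multiplicity. The powers are then
  similar too, and the diagonal of \<open>T ^\<^sub>m k\<close> consists of the k-th powers.\<close>

lemma trace_mat_pow_eigenvalue_mset:
  assumes A: "A \<in> carrier_mat n n"
  shows "trace_mat (A ^\<^sub>m k) = (\<Sum>x\<in>#eigenvalue_mset A. x ^ k)"
proof -
  obtain es where "char_poly A = (\<Prod>a\<leftarrow>es. [:- a, 1:])"
    using char_poly_factorized[OF A] by blast
  from schur_upper_triangular[OF A this] obtain T
    where T: "T \<in> carrier_mat n n" "upper_triangular T" and sim: "similar_mat A T"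
    by blast
  then obtain P Q where wit: "similar_mat_wit A T P Q"
    unfolding similar_mat_def by blast
  \<comment> \<open>\<open>char_poly T\<close> is such a product over the diagonal of
    \<open>T\<close>, so its roots with multiplicity are the diagonal entries.\<close>
  have "proots (\<Prod>a\<leftarrow>xs. [:- a, 1:]) = mset xs" for xs :: "complex list"
    by (induction xs) (simp_all add: proots_mult prod_list_zero_iff image_iff del: mult_pCons_left)
  then have "eigenvalue_mset A = mset (diag_mat T)"
    by (simp add: eigenvalue_mset_def char_poly_similar[OF sim] char_poly_upper_triangular[OF T])
  moreover have "trace_mat (A ^\<^sub>m k) = (\<Sum>x\<leftarrow>diag_mat T. x ^ k)"
    unfolding trace_mat_similar[OF similar_mat_wit_pow[OF wit]]
    using T upper_triangular_pow[OF T, of k]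
    by (simp add: trace_mat_def diag_mat_def sum_list_distinct_conv_sum_set o_def atLeast0LessThan)
  ultimately show ?thesis
    by (simp flip: sum_mset_sum_list)
qed

text \<open>The dimensions may differ a priori; the case k = 0 of the trace condition compares
  them.\<close>

lemma cospectral_if_trace_pow_eq:
  assumes "A \<in> carrier_mat n n" "B \<in> carrier_mat m m"
    and "\<And>k. trace_mat (A ^\<^sub>m k) = trace_mat (B ^\<^sub>m k)"
  shows "cospectral A B"
  unfolding cospectral_def
  using assms by (intro multiset_eq_if_power_sums_eq) (simp flip: trace_mat_pow_eigenvalue_mset)

section \<open>Positive semidefinite matrices\<close>

lemma psd_on_cnj: "psd_on I M \<Longrightarrow> i \<in> I \<Longrightarrow> j \<in> I \<Longrightarrow> cnj (M i j) = M j i"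
  unfolding psd_on_def by (elim conjE, drule (1) bspec, drule (1) bspec, erule sym)

lemma psd_on_nonneg: "psd_on I M \<Longrightarrow> 0 \<le> Re (\<Sum>i\<in>I. \<Sum>j\<in>I. cnj (v i) * M i j * v j)"
  unfolding psd_on_def by (drule conjunct2) (erule spec)

text \<open>This carries positive semidefiniteness from pairs of vertices over to pairs of list
  positions, where adjacency matrices have their indices.\<close>

lemma psd_on_reindex:
  assumes psd: "psd_on I M" and f: "bij_betw f J I"
  shows "psd_on J (\<lambda>i j. M (f i) (f j))"
  unfolding psd_on_def
proof (intro conjI ballI allI)
  show "M (f j) (f i) = cnj (M (f i) (f j))" if "i \<in> J" "j \<in> J" for i j
    using f that by (auto simp: psd_on_cnj[OF psd] bij_betw_def)
  fix v :: "_ \<Rightarrow> complex"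
  define w where "w = v \<circ> the_inv_into J f"
  have w: "w (f i) = v i" if "i \<in> J" for i
    using f that by (auto simp: w_def bij_betw_def the_inv_into_f_f)
  have "(\<Sum>i\<in>J. \<Sum>j\<in>J. cnj (v i) * M (f i) (f j) * v j)
      = (\<Sum>i\<in>J. \<Sum>j\<in>J. cnj (w (f i)) * M (f i) (f j) * w (f j))"
    by (intro sum.cong) (auto simp: w)
  also have "\<dots> = (\<Sum>i\<in>I. \<Sum>j\<in>I. cnj (w i) * M i j * w j)"
    by (simp add: sum.reindex_bij_betw[OF f, where g = "\<lambda>i. \<Sum>j\<in>I. cnj (w i) * M i j * w j"]
        sum.reindex_bij_betw[OF f, where g = "\<lambda>j. cnj (w i) * M i j * w j" for i])
  finally show "0 \<le> Re (\<Sum>i\<in>J. \<Sum>j\<in>J. cnj (v i) * M (f i) (f j) * v j)"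
    using psd_on_nonneg[OF psd] by simp
qed

text \<open>Move from \<open>v\<close> in the direction \<open>u = M v\<close>. The form at
  \<open>v + t u\<close> is a nonnegative real quadratic in \<open>t\<close> without constant term,
  so its linear coefficient, twice the squared norm of \<open>u\<close>, must vanish.\<close>

lemma psd_on_kernel:
  assumes psd: "psd_on I M" and fin: "finite I"
    and v0: "Re (\<Sum>i\<in>I. \<Sum>j\<in>I. cnj (v i) * M i j * v j) = 0"
    and i: "i \<in> I"
  shows "(\<Sum>j\<in>I. M i j * v j) = 0"
proof -
  define q where "q x y = (\<Sum>i\<in>I. \<Sum>j\<in>I. cnj (x i) * M i j * y j)" for x y
  define u where "u i = (\<Sum>j\<in>I. M i j * v j)" for i
  define S where "S = (\<Sum>i\<in>I. (cmod (u i))\<^sup>2)"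
  have uv: "q u v = complex_of_real S"
  proof -
    have "q u v = (\<Sum>i\<in>I. cnj (u i) * u i)"
      by (simp add: q_def u_def mult.assoc flip: sum_distrib_left)
    also have "\<dots> = complex_of_real S"
      unfolding S_def of_real_sum complex_norm_square by (simp add: mult.commute)
    finally show ?thesis .
  qed
  have herm: "q x y = cnj (q y x)" for x y
  proof -
    have "cnj (q y x) = (\<Sum>i\<in>I. \<Sum>j\<in>I. y i * cnj (M i j) * cnj (x j))"
      by (simp add: q_def)
    also have "\<dots> = (\<Sum>i\<in>I. \<Sum>j\<in>I. cnj (x j) * M j i * y i)"
      by (intro sum.cong refl) (simp add: psd_on_cnj[OF psd] mult.commute mult.left_commute)
    also have "\<dots> = q x y"
      unfolding q_def by (rule sum.swap)
    finally show ?thesis by simp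
  qed
  \<comment> \<open>The scalar \<open>t\<close> is real, so conjugation in the first argument leaves
    it unchanged.\<close>
  have left: "q (\<lambda>i. x i + of_real t * y i) z = q x z + of_real t * q y z" for x y z t
    unfolding q_def by (simp add: distrib_right sum.distrib sum_distrib_left mult.assoc)
  have right: "q z (\<lambda>i. x i + of_real t * y i) = q z x + of_real t * q z y" for x y z t
    unfolding q_def
    by (simp add: distrib_left sum.distrib sum_distrib_left mult.left_commute[of "of_real t"])
  have ineq: "0 \<le> 2 * t * S + t\<^sup>2 * Re (q u u)" for t
  proof -
    have "q (\<lambda>i. v i + of_real t * u i) (\<lambda>i. v i + of_real t * u i)
        = q v v + of_real t * (q u v + q v u) + (of_real t)\<^sup>2 * q u u"
      unfolding left right by (simp add: algebra_simps power2_eq_square)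
    moreover have "0 \<le> Re (q (\<lambda>i. v i + of_real t * u i) (\<lambda>i. v i + of_real t * u i))"
      unfolding q_def by (rule psd_on_nonneg[OF psd])
    ultimately show ?thesis
      using v0 by (simp add: herm[of v u] uv flip: q_def of_real_power)
  qed
  have "S = 0"
  proof (rule ccontr)
    assume "S \<noteq> 0"
    define d where "d = S / (Re (q u u) + 1)"
    have c: "Re (q u u) \<ge> 0"
      unfolding q_def by (rule psd_on_nonneg[OF psd])
    then have S: "S = d * (Re (q u u) + 1)" and "d \<noteq> 0"
      using \<open>S \<noteq> 0\<close> by (auto simp: d_def)
    have "2 * (- d) * S + (- d)\<^sup>2 * Re (q u u) = - (d\<^sup>2 * (Re (q u u) + 2))"
      by (simp add: S algebra_simps power2_eq_square)
    moreover have "d\<^sup>2 * (Re (q u u) + 2) > 0"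
      using c \<open>d \<noteq> 0\<close> by simp
    ultimately show False
      using ineq[of "- d"] by simp
  qed
  then show ?thesis
    using fin i by (simp add: S_def sum_nonneg_eq_0_iff flip: u_def)
qed

text \<open>
  If the quadratic form of \<open>M\<close> is summed over the vectors \<open>v g h\<close> of the proof, the two
  diagonal contributions are the squared Frobenius norms of \<open>A\<close> and \<open>B\<close>, and they cancel
  against the cross terms. Hence each \<open>v g h\<close> lies in the kernel of \<open>M\<close>.
\<close>

lemma psd_on_intertwines:
  assumes psd: "psd_on (P \<times> Q) M" and fin: "finite P" "finite Q"
    and P1: "\<And>g g'. g \<in> P \<Longrightarrow> g' \<in> P \<Longrightarrow>
      (\<Sum>h\<in>Q. M (g, h) (g', h)) = (if g = g' then 1 else 0)"
    and Q1: "\<And>h h'. h \<in> Q \<Longrightarrow> h' \<in> Q \<Longrightarrow>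
      (\<Sum>g\<in>P. M (g, h) (g, h')) = (if h = h' then 1 else 0)"
    and A: "(\<Sum>g\<in>P. \<Sum>h\<in>Q. \<Sum>x\<in>P. \<Sum>y\<in>Q. cnj (A g x) * M (x, h) (g, y) * B y h)
      = (\<Sum>g\<in>P. \<Sum>x\<in>P. cnj (A g x) * A g x)"
    and B: "(\<Sum>g\<in>P. \<Sum>h\<in>Q. \<Sum>x\<in>P. \<Sum>y\<in>Q. cnj (A g x) * M (x, h) (g, y) * B y h)
      = (\<Sum>h\<in>Q. \<Sum>y\<in>Q. cnj (B y h) * B y h)"
    and p: "p \<in> P \<times> Q" and g: "g \<in> P" and h: "h \<in> Q"
  shows "(\<Sum>x\<in>P. A g x * M p (x, h)) = (\<Sum>y\<in>Q. M p (g, y) * B y h)"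
proof -
  \<comment> \<open>The coefficients of \<Sum>x. A g x e x h - \<Sum>y. B y h e g y. The claim for
    \<open>g\<close> and \<open>h\<close> says that \<open>M\<close> annihilates this vector. The
    two parts overlap at \<open>(g, h)\<close>, hence a difference of two conditionals.\<close>
  define v where
    "v g h = (\<lambda>(x, y). (if y = h then A g x else 0) - (if x = g then B y h else 0))" for g h
  define cross where
    "cross g h = (\<Sum>x\<in>P. \<Sum>y\<in>Q. cnj (A g x) * M (x, h) (g, y) * B y h)" for g h
  define q where "q g h = (\<Sum>i\<in>P \<times> Q. \<Sum>j\<in>P \<times> Q. cnj (v g h i) * M i j * v g h j)" for g h
  have Mv: "(\<Sum>j\<in>P \<times> Q. M i j * v g h j) = (\<Sum>x\<in>P. M i (x, h) * A g x) - (\<Sum>y\<in>Q. M i (g, y) * B y h)"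
    if "g \<in> P" "h \<in> Q" for g h i
  proof -
    have "(\<Sum>j\<in>P \<times> Q. M i j * v g h j)
        = (\<Sum>x\<in>P. \<Sum>y\<in>Q. if y = h then M i (x, h) * A g x else 0)
          - (\<Sum>x\<in>P. \<Sum>y\<in>Q. if x = g then M i (g, y) * B y h else 0)"
      by (auto simp: v_def sum.cartesian_product' sum_subtractf[symmetric] algebra_simps intro!: sum.cong)
    also have "(\<Sum>x\<in>P. \<Sum>y\<in>Q. if y = h then M i (x, h) * A g x else 0) = (\<Sum>x\<in>P. M i (x, h) * A g x)"
      using fin that by simp
    also have "(\<Sum>x\<in>P. \<Sum>y\<in>Q. if x = g then M i (g, y) * B y h else 0) = (\<Sum>y\<in>Q. M i (g, y) * B y h)"
      using fin that by (subst sum.swap) simp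
    finally show ?thesis .
  qed
  have vf: "(\<Sum>i\<in>P \<times> Q. cnj (v g h i) * f i) = (\<Sum>x\<in>P. cnj (A g x) * f (x, h)) - (\<Sum>y\<in>Q. cnj (B y h) * f (g, y))"
    if "g \<in> P" "h \<in> Q" for g h f
  proof -
    have "(\<Sum>i\<in>P \<times> Q. cnj (v g h i) * f i)
        = (\<Sum>x\<in>P. \<Sum>y\<in>Q. if y = h then cnj (A g x) * f (x, h) else 0)
          - (\<Sum>x\<in>P. \<Sum>y\<in>Q. if x = g then cnj (B y h) * f (g, y) else 0)"
      by (auto simp: v_def sum.cartesian_product' sum_subtractf[symmetric] algebra_simps intro!: sum.cong)
    also have "(\<Sum>x\<in>P. \<Sum>y\<in>Q. if y = h then cnj (A g x) * f (x, h) else 0) = (\<Sum>x\<in>P. cnj (A g x) * f (x, h))"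
      using fin that by simp
    also have "(\<Sum>x\<in>P. \<Sum>y\<in>Q. if x = g then cnj (B y h) * f (g, y) else 0) = (\<Sum>y\<in>Q. cnj (B y h) * f (g, y))"
      using fin that by (subst sum.swap) simp
    finally show ?thesis .
  qed
  \<comment> \<open>The form splits into four blocks; the two mixed ones are conjugate to each other
    because \<open>M\<close> is Hermitian.\<close>
  have q: "q g h = (\<Sum>x\<in>P. \<Sum>x'\<in>P. cnj (A g x) * M (x, h) (x', h) * A g x')
      - cross g h - cnj (cross g h)
      + (\<Sum>y\<in>Q. \<Sum>y'\<in>Q. cnj (B y h) * M (g, y) (g, y') * B y' h)" if "g \<in> P" "h \<in> Q" for g h
  proof -
    have "q g h = (\<Sum>i\<in>P \<times> Q. cnj (v g h i) *
        ((\<Sum>x\<in>P. M i (x, h) * A g x) - (\<Sum>y\<in>Q. M i (g, y) * B y h)))"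
      by (simp add: q_def mult.assoc Mv[OF that] flip: sum_distrib_left)
    also have "\<dots> = (\<Sum>x\<in>P. \<Sum>x'\<in>P. cnj (A g x) * M (x, h) (x', h) * A g x')
        - cross g h - (\<Sum>y\<in>Q. \<Sum>x\<in>P. cnj (B y h) * M (g, y) (x, h) * A g x)
        + (\<Sum>y\<in>Q. \<Sum>y'\<in>Q. cnj (B y h) * M (g, y) (g, y') * B y' h)"
      unfolding vf[OF that] cross_def
      by (simp add: sum_distrib_left sum_subtractf right_diff_distrib mult.assoc)
    also have "(\<Sum>y\<in>Q. \<Sum>x\<in>P. cnj (B y h) * M (g, y) (x, h) * A g x)
        = (\<Sum>y\<in>Q. \<Sum>x\<in>P. cnj (cnj (A g x) * M (x, h) (g, y) * B y h))"
      using that by (intro sum.cong refl) (simp add: psd_on_cnj[OF psd] mult.commute mult.left_commute)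
    also have "\<dots> = cnj (cross g h)"
      by (subst sum.swap) (simp add: cross_def)
    finally show ?thesis .
  qed
  \<comment> \<open>With the sum over \<open>h\<close> moved inside, \<open>P1\<close> replaces the
    block of \<open>M\<close> by the identity matrix.\<close>
  have "(\<Sum>g\<in>P. \<Sum>h\<in>Q. \<Sum>x\<in>P. \<Sum>x'\<in>P. cnj (A g x) * M (x, h) (x', h) * A g x')
      = (\<Sum>g\<in>P. \<Sum>x\<in>P. \<Sum>x'\<in>P. cnj (A g x) * (\<Sum>h\<in>Q. M (x, h) (x', h)) * A g x')"
    unfolding sum_distrib_left sum_distrib_right
    by (rule sum.cong[OF refl], subst sum.swap, rule sum.cong[OF refl], rule sum.swap)
  also have "\<dots> = (\<Sum>g\<in>P. \<Sum>x\<in>P. cnj (A g x) * A g x)"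
    using fin by (intro sum.cong refl) (simp add: P1
        if_distrib[of "\<lambda>x. _ * x * _"] if_distrib[of "\<lambda>x. _ * x"] if_distrib[of "\<lambda>x. x * _"] cong: if_cong)
  finally have AA: "(\<Sum>g\<in>P. \<Sum>h\<in>Q. \<Sum>x\<in>P. \<Sum>x'\<in>P. cnj (A g x) * M (x, h) (x', h) * A g x')
      = (\<Sum>g\<in>P. \<Sum>x\<in>P. cnj (A g x) * A g x)" .
  have "(\<Sum>g\<in>P. \<Sum>h\<in>Q. \<Sum>y\<in>Q. \<Sum>y'\<in>Q. cnj (B y h) * M (g, y) (g, y') * B y' h)
      = (\<Sum>h\<in>Q. \<Sum>y\<in>Q. \<Sum>y'\<in>Q. cnj (B y h) * (\<Sum>g\<in>P. M (g, y) (g, y')) * B y' h)"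
    unfolding sum_distrib_left sum_distrib_right
    by (subst sum.swap, rule sum.cong[OF refl], subst sum.swap, rule sum.cong[OF refl], rule sum.swap)
  also have "\<dots> = (\<Sum>h\<in>Q. \<Sum>y\<in>Q. cnj (B y h) * B y h)"
    using fin by (intro sum.cong refl) (simp add: Q1
        if_distrib[of "\<lambda>x. _ * x * _"] if_distrib[of "\<lambda>x. _ * x"] if_distrib[of "\<lambda>x. x * _"] cong: if_cong)
  finally have BB: "(\<Sum>g\<in>P. \<Sum>h\<in>Q. \<Sum>y\<in>Q. \<Sum>y'\<in>Q. cnj (B y h) * M (g, y) (g, y') * B y' h)
      = (\<Sum>h\<in>Q. \<Sum>y\<in>Q. cnj (B y h) * B y h)" .
  define c where "c = (\<Sum>g\<in>P. \<Sum>h\<in>Q. cross g h)"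
  \<comment> \<open>By \<open>A\<close> and \<open>B\<close> both diagonal contributions equal
    \<open>c\<close>, so the total is c minus its conjugate and has real part zero.\<close>
  have "(\<Sum>g\<in>P. \<Sum>h\<in>Q. q g h) = c - c - cnj c + c"
    using A B by (simp add: q AA BB sum.distrib sum_subtractf c_def flip: cross_def cnj_sum)
  then have "Re (\<Sum>g\<in>P. \<Sum>h\<in>Q. q g h) = 0"
    by simp
  then have "(\<Sum>i\<in>P \<times> Q. Re (q (fst i) (snd i))) = 0"
    by (simp add: sum.cartesian_product')
  moreover have "0 \<le> Re (q g h)" for g h
    unfolding q_def by (rule psd_on_nonneg[OF psd])
  ultimately have "Re (q g h) = 0"
    using fin g h by (subst (asm) sum_nonneg_eq_0_iff) auto
  from psd_on_kernel[OF psd _ this[unfolded q_def] p] fin show ?thesis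
    by (simp add: Mv[OF g h] mult.commute)
qed

section \<open>Traces of powers of intertwined matrices\<close>

lemma pow_mat_intertwines:
  fixes A B N :: "'a::semiring_1 mat"
  assumes A: "A \<in> carrier_mat n n" and B: "B \<in> carrier_mat m m" and N: "N \<in> carrier_mat n m"
    and AN: "A * N = N * B"
  shows "A ^\<^sub>m k * N = N * B ^\<^sub>m k"
proof (induction k)
  case 0
  show ?case using A B N by simp
next
  case (Suc k)
  have Ak: "A ^\<^sub>m k \<in> carrier_mat n n" and Bk: "B ^\<^sub>m k \<in> carrier_mat m m"
    using A B by auto
  have "A ^\<^sub>m Suc k * N = A ^\<^sub>m k * (N * B)"
    using assoc_mult_mat[OF Ak A N] AN by simp
  also have "\<dots> = N * B ^\<^sub>m Suc k"
    using assoc_mult_mat[OF Ak N B] assoc_mult_mat[OF N Bk B] Suc by simp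
  finally show ?case .
qed

text \<open>Write the trace of \<open>A ^\<^sub>m k\<close> with a Kronecker delta and expand the
  delta by \<open>P1\<close>. The result sums the \<open>(i, j)\<close> entries of
  \<open>A ^\<^sub>m k * N (i, j)\<close>, where \<open>N p\<close> is row \<open>p\<close> of
  \<open>M\<close> read as a matrix. Moving the power to the right as \<open>B ^\<^sub>m k\<close>
  and contracting over \<open>i\<close> by \<open>Q1\<close> gives the other trace.\<close>

lemma trace_pow_eq_if_intertwines:
  fixes A B :: "'a::comm_semiring_1 mat" and M :: "nat \<times> nat \<Rightarrow> nat \<times> nat \<Rightarrow> 'a"
  assumes A: "A \<in> carrier_mat n n" and B: "B \<in> carrier_mat m m"
    and P1: "\<And>i i'. i < n \<Longrightarrow> i' < n \<Longrightarrow>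
      (\<Sum>j<m. M (i, j) (i', j)) = (if i = i' then 1 else 0)"
    and Q1: "\<And>j j'. j < m \<Longrightarrow> j' < m \<Longrightarrow>
      (\<Sum>i<n. M (i, j) (i, j')) = (if j = j' then 1 else 0)"
    and AM: "\<And>p i j. p \<in> {..<n} \<times> {..<m} \<Longrightarrow> i < n \<Longrightarrow> j < m \<Longrightarrow>
      (\<Sum>l<n. A $$ (i, l) * M p (l, j)) = (\<Sum>l<m. M p (i, l) * B $$ (l, j))"
  shows "trace_mat (A ^\<^sub>m k) = trace_mat (B ^\<^sub>m k)"
proof -
  define N where "N p = mat n m (M p)" for p
  have N: "N p \<in> carrier_mat n m" for p
    by (simp add: N_def)
  have NAB: "(A ^\<^sub>m k * N p) $$ (i, j) = (N p * B ^\<^sub>m k) $$ (i, j)"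
    if "p \<in> {..<n} \<times> {..<m}" for p i j
  proof -
    have "A * N p = N p * B"
      using A B N[of p] AM[OF that]
      by (intro eq_matI) (auto simp: scalar_prod_def atLeast0LessThan N_def)
    then show ?thesis
      using pow_mat_intertwines[OF A B N] by simp
  qed
  have "trace_mat (A ^\<^sub>m k) = (\<Sum>i<n. \<Sum>l<n. (A ^\<^sub>m k) $$ (i, l) * (\<Sum>j<m. M (i, j) (l, j)))"
    using A by (simp add: trace_mat_def P1 if_distrib cong: if_cong)
  also have "\<dots> = (\<Sum>i<n. \<Sum>j<m. (A ^\<^sub>m k * N (i, j)) $$ (i, j))"
    by (rule sum.cong[OF refl], unfold sum_distrib_left, subst sum.swap)
      (use A in \<open>simp add: N_def scalar_prod_def atLeast0LessThan\<close>)
  also have "\<dots> = (\<Sum>i<n. \<Sum>j<m. (N (i, j) * B ^\<^sub>m k) $$ (i, j))"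
    by (simp add: NAB)
  also have "\<dots> = (\<Sum>i<n. \<Sum>j<m. \<Sum>l<m. M (i, j) (i, l) * (B ^\<^sub>m k) $$ (l, j))"
    using B by (simp add: N_def scalar_prod_def atLeast0LessThan)
  also have "\<dots> = (\<Sum>j<m. \<Sum>l<m. (\<Sum>i<n. M (i, j) (i, l)) * (B ^\<^sub>m k) $$ (l, j))"
    unfolding sum_distrib_right by (subst sum.swap, rule sum.cong[OF refl], rule sum.swap)
  also have "\<dots> = trace_mat (B ^\<^sub>m k)"
    using B by (simp add: trace_mat_def Q1 if_distrib[of "\<lambda>x. x * _"] cong: if_cong)
  finally show ?thesis .
qed

section \<open>Graphs\<close>

lemma sum_eq_sum_diagonal:
  fixes f :: "'a \<Rightarrow> 'a \<Rightarrow> 'b::comm_monoid_add"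
  assumes "finite S" "\<And>x y. x \<in> S \<Longrightarrow> y \<in> S \<Longrightarrow> x \<noteq> y \<Longrightarrow> f x y = 0"
  shows "(\<Sum>x\<in>S. \<Sum>y\<in>S. f x y) = (\<Sum>x\<in>S. f x x)"
proof -
  have "(\<Sum>y\<in>S. f x y) = (\<Sum>y\<in>S. if x = y then f x x else 0)" if "x \<in> S" for x
    using assms(2) that by (intro sum.cong) auto
  then show ?thesis using assms(1) by simp
qed

text \<open>After reindexing by list positions, the zero pattern and block sums of \<open>M\<close>
  supply the hypotheses of \<open>psd_on_intertwines\<close>; equality of all traces of powers
  follows.\<close>

lemma cospectral_if_psd_isomorphic:
  fixes G :: "'a pair_pre_digraph" and H :: "'b pair_pre_digraph"
  assumes G: "pair_graph G" and H: "pair_graph H"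
    and gs: "distinct gs" "set gs = pverts G"
    and hs: "distinct hs" "set hs = pverts H"
    and GH: "G \<cong>\<^sub>S\<^sub>+ H"
  shows "cospectral (adjacency_matrix gs G) (adjacency_matrix hs H)"
proof -
  obtain M where psd: "psd_on (pverts G \<times> pverts H) M"
    and g1: "\<And>g g'. g \<in> pverts G \<Longrightarrow> g' \<in> pverts G \<Longrightarrow>
      (\<Sum>h\<in>pverts H. \<Sum>h'\<in>pverts H. M (g, h) (g', h')) = 1"
    and h1: "\<And>h h'. h \<in> pverts H \<Longrightarrow> h' \<in> pverts H \<Longrightarrow>
      (\<Sum>g\<in>pverts G. \<Sum>g'\<in>pverts G. M (g, h) (g', h')) = 1"
    and rel0: "\<And>g g' h h'. g \<in> pverts G \<Longrightarrow> g' \<in> pverts G \<Longrightarrow> h \<in> pverts H \<Longrightarrow> h' \<in> pverts H \<Longrightarrow>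
      rel G g g' \<noteq> rel H h h' \<Longrightarrow> M (g, h) (g', h') = 0"
    using GH unfolding psd_isomorphic_def by blast
  define n where "n = length gs"
  define m where "m = length hs"
  define f where "f = map_prod ((!) gs) ((!) hs)"
  define N where "N = (\<lambda>p q. M (f p) (f q))"
  define A where "A = adjacency_matrix gs G"
  define B where "B = adjacency_matrix hs H"
  have bijG: "bij_betw ((!) gs) {..<n} (pverts G)"
    using gs bij_betw_nth[of gs] by (simp add: n_def)
  have bijH: "bij_betw ((!) hs) {..<m} (pverts H)"
    using hs bij_betw_nth[of hs] by (simp add: m_def)
  have memG: "gs ! i \<in> pverts G" if "i < n" for i
    using bij_betwE[OF bijG] that by blast
  have memH: "hs ! j \<in> pverts H" if "j < m" for j
    using bij_betwE[OF bijH] that by blast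
  have relG: "rel G (gs ! i) (gs ! i')
      = (if i = i' then Equal else if A $$ (i, i') = 1 then Adjacent else NonAdjacent)"
    if "i < n" "i' < n" for i i'
    using that gs(1) by (auto simp: rel_def A_def adjacency_matrix_def n_def nth_eq_iff_index_eq)
  have relH: "rel H (hs ! j) (hs ! j')
      = (if j = j' then Equal else if B $$ (j, j') = 1 then Adjacent else NonAdjacent)"
    if "j < m" "j' < m" for j j'
    using that hs(1) by (auto simp: rel_def B_def adjacency_matrix_def m_def nth_eq_iff_index_eq)
  have A: "A \<in> carrier_mat n n" and B: "B \<in> carrier_mat m m"
    by (auto simp: A_def B_def adjacency_matrix_def n_def m_def)
  have A01: "A $$ (i, i') = 0 \<or> A $$ (i, i') = 1" if "i < n" "i' < n" for i i'
    using that by (auto simp: A_def adjacency_matrix_def n_def)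
  have B01: "B $$ (j, j') = 0 \<or> B $$ (j, j') = 1" if "j < m" "j' < m" for j j'
    using that by (auto simp: B_def adjacency_matrix_def m_def)
  have Adiag: "A $$ (i, i) = 0" if "i < n" for i
    using that pair_loopfree_digraph.pair_no_loops[of G "(gs ! i, gs ! i)"]
      pair_digraph.axioms(2) pair_graph.axioms(1)[OF G]
    by (auto simp: A_def adjacency_matrix_def n_def)
  have Bdiag: "B $$ (j, j) = 0" if "j < m" for j
    using that pair_loopfree_digraph.pair_no_loops[of H "(hs ! j, hs ! j)"]
      pair_digraph.axioms(2) pair_graph.axioms(1)[OF H]
    by (auto simp: B_def adjacency_matrix_def m_def)
  have "bij_betw f ({..<n} \<times> {..<m}) (pverts G \<times> pverts H)"
    using bijG bijH unfolding f_def bij_betw_def by (auto intro!: map_prod_inj_on map_prod_surj_on)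
  then have psdN: "psd_on ({..<n} \<times> {..<m}) N"
    unfolding N_def by (rule psd_on_reindex[OF psd])
  have N1: "(\<Sum>j<m. \<Sum>j'<m. N (i, j) (i', j')) = 1" if "i < n" "i' < n" for i i'
    using g1[OF memG memG, OF that]
    by (simp add: N_def f_def sum.reindex_bij_betw[OF bijH, of "\<lambda>h'. M _ (_, h')"]
        sum.reindex_bij_betw[OF bijH, of "\<lambda>h. \<Sum>h'\<in>pverts H. M (_, h) (_, h')"])
  have N2: "(\<Sum>i<n. \<Sum>i'<n. N (i, j) (i', j')) = 1" if "j < m" "j' < m" for j j'
    using h1[OF memH memH, OF that]
    by (simp add: N_def f_def sum.reindex_bij_betw[OF bijG, of "\<lambda>g'. M _ (g', _)"]
        sum.reindex_bij_betw[OF bijG, of "\<lambda>g. \<Sum>g'\<in>pverts G. M (g, _) (g', _)"])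
  have N0: "N (i, j) (i', j') = 0"
    if "i < n" "i' < n" "j < m" "j' < m" "rel G (gs ! i) (gs ! i') \<noteq> rel H (hs ! j) (hs ! j')"
    for i i' j j'
    using rel0[OF memG memG memH memH, OF that] by (simp add: N_def f_def)
  have N0_eq: "N (i, j) (i', j') = 0"
    if "i < n" "i' < n" "j < m" "j' < m" "(i = i') \<noteq> (j = j')" for i i' j j'
    using that by (intro N0) (auto simp: relG relH)
  \<comment> \<open>Two pairs related by \<open>Equal\<close> both have entry 0, as there are no
    loops. So different entries always mean different relationships.\<close>
  have N0_adj: "N (i, j) (i', j') = 0"
    if "i < n" "i' < n" "j < m" "j' < m" "A $$ (i, i') \<noteq> B $$ (j, j')" for i i' j j'
    using that A01[of i i'] B01[of j j'] by (intro N0) (auto simp: relG relH Adiag Bdiag)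
  \<comment> \<open>Wherever \<open>N (x, j) (i, y)\<close> is nonzero, the entries of
    \<open>A\<close> and \<open>B\<close> agree, so either may replace the other. Each cross term
    thereby involves the entries of one graph only.\<close>
  have NAB: "cnj (A $$ (i, x)) * N (x, j) (i, y) * B $$ (y, j)
        = cnj (A $$ (i, x)) * A $$ (i, x) * N (x, j) (i, y)"
      "cnj (A $$ (i, x)) * N (x, j) (i, y) * B $$ (y, j)
        = cnj (B $$ (y, j)) * B $$ (y, j) * N (x, j) (i, y)"
    if "i < n" "x < n" "j < m" "y < m" for i x j y
  proof -
    have "N (x, j) (i, y) = 0" if "A $$ (i, x) \<noteq> B $$ (y, j)"
      using N0_adj[of i x y j] psd_on_cnj[OF psdN, of "(i, y)" "(x, j)"]
        \<open>i < n\<close> \<open>x < n\<close> \<open>j < m\<close> \<open>y < m\<close> that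
      by simp
    then show "cnj (A $$ (i, x)) * N (x, j) (i, y) * B $$ (y, j)
        = cnj (A $$ (i, x)) * A $$ (i, x) * N (x, j) (i, y)"
      and "cnj (A $$ (i, x)) * N (x, j) (i, y) * B $$ (y, j)
        = cnj (B $$ (y, j)) * B $$ (y, j) * N (x, j) (i, y)"
      by (cases "A $$ (i, x) = B $$ (y, j)"; simp)+
  qed
  \<comment> \<open>For equal indices only the diagonal of the block can be nonzero, so its trace is
    the full block sum 1. For different indices every term on the diagonal is zero.\<close>
  have P1: "(\<Sum>j<m. N (i, j) (i', j)) = (if i = i' then 1 else 0)" if "i < n" "i' < n" for i i'
  proof (cases "i = i'")
    case True
    then show ?thesis
      using N1[OF that] that sum_eq_sum_diagonal[of "{..<m}" "\<lambda>j j'. N (i, j) (i', j')"]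
      by (simp add: N0_eq)
  qed (simp add: N0_eq that)
  have Q1: "(\<Sum>i<n. N (i, j) (i, j')) = (if j = j' then 1 else 0)" if "j < m" "j' < m" for j j'
  proof (cases "j = j'")
    case True
    then show ?thesis
      using N2[OF that] that sum_eq_sum_diagonal[of "{..<n}" "\<lambda>i i'. N (i, j) (i', j')"]
      by (simp add: N0_eq)
  qed (simp add: N0_eq that)
  \<comment> \<open>Once \<open>B\<close> is traded for \<open>A\<close>, the sum over
    \<open>j\<close> and \<open>y\<close> meets only \<open>N\<close> and is a block sum equal to
    1.\<close>
  have sumA: "(\<Sum>i<n. \<Sum>j<m. \<Sum>x<n. \<Sum>y<m. cnj (A $$ (i, x)) * N (x, j) (i, y) * B $$ (y, j))
      = (\<Sum>i<n. \<Sum>x<n. cnj (A $$ (i, x)) * A $$ (i, x))"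
  proof -
    have "(\<Sum>i<n. \<Sum>j<m. \<Sum>x<n. \<Sum>y<m. cnj (A $$ (i, x)) * N (x, j) (i, y) * B $$ (y, j))
        = (\<Sum>i<n. \<Sum>j<m. \<Sum>x<n. \<Sum>y<m. cnj (A $$ (i, x)) * A $$ (i, x) * N (x, j) (i, y))"
      by (intro sum.cong refl) (simp add: NAB(1))
    also have "\<dots> = (\<Sum>i<n. \<Sum>x<n. cnj (A $$ (i, x)) * A $$ (i, x) * (\<Sum>j<m. \<Sum>y<m. N (x, j) (i, y)))"
      unfolding sum_distrib_left by (rule sum.cong[OF refl], rule sum.swap)
    finally show ?thesis by (simp add: N1)
  qed
  \<comment> \<open>Dually, \<open>A\<close> is traded for \<open>B\<close>, and the sums over
    \<open>i\<close> and \<open>x\<close> are moved inside to form a block sum.\<close>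
  have sumB: "(\<Sum>i<n. \<Sum>j<m. \<Sum>x<n. \<Sum>y<m. cnj (A $$ (i, x)) * N (x, j) (i, y) * B $$ (y, j))
      = (\<Sum>j<m. \<Sum>y<m. cnj (B $$ (y, j)) * B $$ (y, j))"
  proof -
    have "(\<Sum>i<n. \<Sum>j<m. \<Sum>x<n. \<Sum>y<m. cnj (A $$ (i, x)) * N (x, j) (i, y) * B $$ (y, j))
        = (\<Sum>i<n. \<Sum>j<m. \<Sum>x<n. \<Sum>y<m. cnj (B $$ (y, j)) * B $$ (y, j) * N (x, j) (i, y))"
      by (intro sum.cong refl) (simp add: NAB(2))
    also have "\<dots> = (\<Sum>j<m. \<Sum>i<n. \<Sum>y<m. \<Sum>x<n. cnj (B $$ (y, j)) * B $$ (y, j) * N (x, j) (i, y))"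
      by (subst sum.swap, rule sum.cong[OF refl], rule sum.cong[OF refl], rule sum.swap)
    also have "\<dots> = (\<Sum>j<m. \<Sum>y<m. \<Sum>x<n. \<Sum>i<n. cnj (B $$ (y, j)) * B $$ (y, j) * N (x, j) (i, y))"
      by (rule sum.cong[OF refl], subst sum.swap, rule sum.cong[OF refl], rule sum.swap)
    also have "\<dots> = (\<Sum>j<m. \<Sum>y<m. cnj (B $$ (y, j)) * B $$ (y, j))"
      by (simp add: N2 flip: sum_distrib_left)
    finally show ?thesis .
  qed
  have "(\<Sum>l<n. A $$ (i, l) * N p (l, j)) = (\<Sum>l<m. N p (i, l) * B $$ (l, j))"
    if "p \<in> {..<n} \<times> {..<m}" "i < n" "j < m" for p i j
    by (rule psd_on_intertwines[OF psdN, where A = "\<lambda>i x. A $$ (i, x)" and B = "\<lambda>y j. B $$ (y, j)"])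
       (use that P1 Q1 sumA sumB in auto)
  then have "trace_mat (A ^\<^sub>m k) = trace_mat (B ^\<^sub>m k)" for k
    by (intro trace_pow_eq_if_intertwines[OF A B P1 Q1]) auto
  then show ?thesis
    unfolding A_def[symmetric] B_def[symmetric] by (rule cospectral_if_trace_pow_eq[OF A B])
qed

section \<open>Passing to complements\<close>

lemma rel_complement:
  assumes "x \<in> pverts G" "y \<in> pverts G"
  shows "rel (complement G) x y =
    (case rel G x y of Equal \<Rightarrow> Equal | Adjacent \<Rightarrow> NonAdjacent | NonAdjacent \<Rightarrow> Adjacent)"
  using assms by (simp add: rel_def complement_def)

text \<open>Complementation acts on relationships by a permutation, so the same pairs disagree
  before and after, and the same matrix is a witness.\<close>

lemma psd_isomorphic_complement:
  assumes "G \<cong>\<^sub>S\<^sub>+ H"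
  shows "complement G \<cong>\<^sub>S\<^sub>+ complement H"
proof -
  have "pverts (complement G) = pverts G" "pverts (complement H) = pverts H"
    by (simp_all add: complement_def)
  moreover have "rel (complement G) x y = rel (complement H) z w \<longleftrightarrow> rel G x y = rel H z w"
    if "x \<in> pverts G" "y \<in> pverts G" "z \<in> pverts H" "w \<in> pverts H" for x y z w
    using that by (simp add: rel_complement split: relationship.split)
  ultimately show ?thesis
    using assms unfolding psd_isomorphic_def by (simp cong: ball_cong)
qed

theorem lemma5p3:
  fixes G :: "'a pair_pre_digraph" and H :: "'b pair_pre_digraph"
    and gs :: "'a list" and hs :: "'b list"
  assumes "pair_graph G" and "pair_graph H"
    and "distinct gs" and "set gs = pverts G"
    and "distinct hs" and "set hs = pverts H"
    and "G \<cong>\<^sub>S\<^sub>+ H"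
  shows "cospectral (adjacency_matrix gs G) (adjacency_matrix hs H) \<and>
         cospectral (adjacency_matrix gs (complement G)) (adjacency_matrix hs (complement H))"
proof
  show "cospectral (adjacency_matrix gs G) (adjacency_matrix hs H)"
    by (rule cospectral_if_psd_isomorphic) fact+
  show "cospectral (adjacency_matrix gs (complement G)) (adjacency_matrix hs (complement H))"
  proof (rule cospectral_if_psd_isomorphic)
    show "pair_graph (complement G)" "pair_graph (complement H)"
      using assms by (simp_all add: pair_graph_complement)
    show "set gs = pverts (complement G)" "set hs = pverts (complement H)"
      using assms by (simp_all add: complement_def)
    show "complement G \<cong>\<^sub>S\<^sub>+ complement H"
      using assms by (simp add: psd_isomorphic_complement)
  qed fact+
qed

end
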